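(* There is an algorithm which, given a finite set $\mathbf{R}$ of $n$ decision procedures with runtimes $t_1,\dots,t_n$ and qualities $q_1,\dots,q_n$, and a long uniform deadline distribution (i.e. the deadline is uniformly distributed on an interval $[0,D]$ with $D>\sum_{i=1}^n t_i$), determines an optimal sequence of decision procedures from $\mathbf{R}$ in $O(n^2)$ time.
   Context: A decision procedure (rule) $r$ has an integer runtime $t_r\ge 0$ and a real quality $q_r\ge 0$. A sequence (agent program) is a finite nonempty sequence $s=s_1\ldots s_m$ of elements of the finite set $\mathbf{R}$; its rules are run in order. A deadline occurs at a random nonnegative time with cumulative distribution function $P_d$ and is announced when it arrives; the agent then executes the action of the highest-quality rule completed so far. The value of $s$ is $$V(s)=\sum_{i=1}^{m}\Big[P_d\Big(\sum_{j=1}^{i+1}t_{s_j}\Big)-P_d\Big(\sum_{j=1}^{i}t_{s_j}\Big)\Big]Q_i,\qquad Q_i=\max\{q_{s_1},\dots,q_{s_i}\},$$ where for $i=m$ the term $P_d(\sum_{j=1}^{m+1}t_{s_j})$ is read as $1$. A sequence is optimal if it maximizes $V$ among all sequences over $\mathbf{R}$. Running time counts arithmetic operations and comparisons on real numbers and evaluations of $P_d$ as unit-cost steps. *)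

theory Defs
  imports "HOL-Probability.Probability" "HOL-Library.Landau_Symbols"
begin

definition sequences :: "'r set \<Rightarrow> 'r list set" where
  "sequences R = {s. s \<noteq> [] \<and> set s \<subseteq> R}"

text \<open>
  Lists are indexed from 0, so the summand for \<open>i\<close> below is the one for the \<open>(i+1)\<close>-st rule
  of the sequence. \<open>P\<close> is the cumulative distribution function of the deadline. It is replaced
  by 1 at the end of the sequence: once all rules have been run, the best action found so far
  is executed whenever the deadline arrives.
\<close>

definition seq_value :: "(real \<Rightarrow> real) \<Rightarrow> ('r \<Rightarrow> nat) \<Rightarrow> ('r \<Rightarrow> real) \<Rightarrow> 'r list \<Rightarrow> real" where
  "seq_value P t q s =
     (\<Sum>i<length s.
        ((if Suc i = length s then 1 else P (real (\<Sum>j\<le>Suc i. t (s ! j))))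
           - P (real (\<Sum>j\<le>i. t (s ! j))))
        * Max ((\<lambda>j. q (s ! j)) ` {..i}))"

definition optimal_sequence ::
  "'r set \<Rightarrow> (real \<Rightarrow> real) \<Rightarrow> ('r \<Rightarrow> nat) \<Rightarrow> ('r \<Rightarrow> real) \<Rightarrow> 'r list \<Rightarrow> bool" where
  "optimal_sequence R P t q s \<longleftrightarrow>
     s \<in> sequences R \<and> (\<forall>s' \<in> sequences R. seq_value P t q s' \<le> seq_value P t q s)"

text \<open>
  Algorithms are programs of a small imperative language over two sorts of memory: natural
  numbers, used as counters and array indices, and real numbers. Both consist of named infinite
  arrays; a scalar variable is an array of which only index 0 is used. A program mentions only
  finitely many names, so that up to constant factors this is a real RAM. As usual for that
  model there is no conversion (such as rounding) between reals and indices, and only integer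
  constants occur in programs. The deadline distribution is available only through evaluation of
  its distribution function, by the expression \<open>REval\<close>.
\<close>

record mem =
  nat_mem :: "string \<Rightarrow> nat \<Rightarrow> nat"
  real_mem :: "string \<Rightarrow> nat \<Rightarrow> real"

datatype nexp =
    NConst nat
  | NGet string nexp
  | NAdd nexp nexp
  | NSub nexp nexp

datatype rexp =
    RConst int
  | RGet string nexp
  | RAdd rexp rexp
  | RSub rexp rexp
  | RMul rexp rexp
  | RDiv rexp rexp
  | REval rexp

datatype bexp =
    NLess nexp nexp
  | NEq nexp nexp
  | RLess rexp rexp
  | REq rexp rexp
  | BNot bexp
  | BAnd bexp bexp

datatype com =
    Skip
  | NSet string nexp nexp
  | RSet string nexp rexp
  | Seq com com
  | If bexp com com
  | While bexp com

text \<open>Subtraction of indices is truncated, and division of reals by 0 yields 0.\<close>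

primrec nval :: "mem \<Rightarrow> nexp \<Rightarrow> nat" where
  "nval \<sigma> (NConst c) = c"
| "nval \<sigma> (NGet a e) = nat_mem \<sigma> a (nval \<sigma> e)"
| "nval \<sigma> (NAdd e e') = nval \<sigma> e + nval \<sigma> e'"
| "nval \<sigma> (NSub e e') = nval \<sigma> e - nval \<sigma> e'"

primrec rval :: "(real \<Rightarrow> real) \<Rightarrow> mem \<Rightarrow> rexp \<Rightarrow> real" where
  "rval P \<sigma> (RConst c) = of_int c"
| "rval P \<sigma> (RGet a e) = real_mem \<sigma> a (nval \<sigma> e)"
| "rval P \<sigma> (RAdd e e') = rval P \<sigma> e + rval P \<sigma> e'"
| "rval P \<sigma> (RSub e e') = rval P \<sigma> e - rval P \<sigma> e'"
| "rval P \<sigma> (RMul e e') = rval P \<sigma> e * rval P \<sigma> e'"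
| "rval P \<sigma> (RDiv e e') = rval P \<sigma> e / rval P \<sigma> e'"
| "rval P \<sigma> (REval e) = P (rval P \<sigma> e)"

primrec bval :: "(real \<Rightarrow> real) \<Rightarrow> mem \<Rightarrow> bexp \<Rightarrow> bool" where
  "bval P \<sigma> (NLess e e') \<longleftrightarrow> nval \<sigma> e < nval \<sigma> e'"
| "bval P \<sigma> (NEq e e') \<longleftrightarrow> nval \<sigma> e = nval \<sigma> e'"
| "bval P \<sigma> (RLess e e') \<longleftrightarrow> rval P \<sigma> e < rval P \<sigma> e'"
| "bval P \<sigma> (REq e e') \<longleftrightarrow> rval P \<sigma> e = rval P \<sigma> e'"
| "bval P \<sigma> (BNot b) \<longleftrightarrow> \<not> bval P \<sigma> b"
| "bval P \<sigma> (BAnd b b') \<longleftrightarrow> bval P \<sigma> b \<and> bval P \<sigma> b'"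

text \<open>
  Every node of an expression costs one step: besides real arithmetic, real comparisons and
  evaluations of the distribution function, this also charges for constants, memory accesses,
  index arithmetic and Boolean connectives.
\<close>

primrec ncost :: "nexp \<Rightarrow> nat" where
  "ncost (NConst c) = 1"
| "ncost (NGet a e) = 1 + ncost e"
| "ncost (NAdd e e') = 1 + ncost e + ncost e'"
| "ncost (NSub e e') = 1 + ncost e + ncost e'"

primrec rcost :: "rexp \<Rightarrow> nat" where
  "rcost (RConst c) = 1"
| "rcost (RGet a e) = 1 + ncost e"
| "rcost (RAdd e e') = 1 + rcost e + rcost e'"
| "rcost (RSub e e') = 1 + rcost e + rcost e'"
| "rcost (RMul e e') = 1 + rcost e + rcost e'"
| "rcost (RDiv e e') = 1 + rcost e + rcost e'"
| "rcost (REval e) = 1 + rcost e"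

primrec bcost :: "bexp \<Rightarrow> nat" where
  "bcost (NLess e e') = 1 + ncost e + ncost e'"
| "bcost (NEq e e') = 1 + ncost e + ncost e'"
| "bcost (RLess e e') = 1 + rcost e + rcost e'"
| "bcost (REq e e') = 1 + rcost e + rcost e'"
| "bcost (BNot b) = 1 + bcost b"
| "bcost (BAnd b b') = 1 + bcost b + bcost b'"

definition nat_upd :: "string \<Rightarrow> nat \<Rightarrow> nat \<Rightarrow> mem \<Rightarrow> mem" where
  "nat_upd a i v \<sigma> = \<sigma>\<lparr>nat_mem := (nat_mem \<sigma>)(a := (nat_mem \<sigma> a)(i := v))\<rparr>"

definition real_upd :: "string \<Rightarrow> nat \<Rightarrow> real \<Rightarrow> mem \<Rightarrow> mem" where
  "real_upd a i v \<sigma> = \<sigma>\<lparr>real_mem := (real_mem \<sigma>)(a := (real_mem \<sigma> a)(i := v))\<rparr>"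

text \<open>
  \<open>exec P c \<sigma> k \<sigma>'\<close>: started in \<open>\<sigma>\<close>, the program \<open>c\<close> with access to the distribution
  function \<open>P\<close> terminates in \<open>\<sigma>'\<close> after exactly \<open>k\<close> steps.
\<close>

inductive exec :: "(real \<Rightarrow> real) \<Rightarrow> com \<Rightarrow> mem \<Rightarrow> nat \<Rightarrow> mem \<Rightarrow> bool" for P where
  Skip: "exec P Skip \<sigma> 1 \<sigma>"
| NSet: "exec P (NSet a e e') \<sigma> (1 + ncost e + ncost e') (nat_upd a (nval \<sigma> e) (nval \<sigma> e') \<sigma>)"
| RSet: "exec P (RSet a e e') \<sigma> (1 + ncost e + rcost e') (real_upd a (nval \<sigma> e) (rval P \<sigma> e') \<sigma>)"
| Seq: "exec P c \<sigma> k \<sigma>' \<Longrightarrow> exec P c' \<sigma>' k' \<sigma>'' \<Longrightarrow> exec P (Seq c c') \<sigma> (k + k') \<sigma>''"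
| IfTrue: "bval P \<sigma> b \<Longrightarrow> exec P c \<sigma> k \<sigma>' \<Longrightarrow> exec P (If b c c') \<sigma> (1 + bcost b + k) \<sigma>'"
| IfFalse: "\<not> bval P \<sigma> b \<Longrightarrow> exec P c' \<sigma> k \<sigma>' \<Longrightarrow> exec P (If b c c') \<sigma> (1 + bcost b + k) \<sigma>'"
| WhileFalse: "\<not> bval P \<sigma> b \<Longrightarrow> exec P (While b c) \<sigma> (1 + bcost b) \<sigma>"
| WhileTrue: "bval P \<sigma> b \<Longrightarrow> exec P c \<sigma> k \<sigma>' \<Longrightarrow> exec P (While b c) \<sigma>' k' \<sigma>'' \<Longrightarrow>
    exec P (While b c) \<sigma> (1 + bcost b + k + k') \<sigma>''"

inductive_cases SkipE: "exec P Skip \<sigma> k \<sigma>'"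
inductive_cases NSetE: "exec P (NSet a e e') \<sigma> k \<sigma>'"
inductive_cases RSetE: "exec P (RSet a e e') \<sigma> k \<sigma>'"
inductive_cases SeqE: "exec P (Seq c c') \<sigma> k \<sigma>'"
inductive_cases IfE: "exec P (If b c c') \<sigma> k \<sigma>'"
inductive_cases WhileE: "exec P (While b c) \<sigma> k \<sigma>'"

lemma exec_deterministic:
  assumes "exec P c \<sigma> k \<sigma>'" and "exec P c \<sigma> l \<tau>"
  shows "l = k \<and> \<tau> = \<sigma>'"
  using assms
proof (induction arbitrary: l \<tau> rule: exec.induct)
  case (Skip \<sigma>)
  then show ?case by (elim SkipE) simp
next
  case (NSet a e e' \<sigma>)
  then show ?case by (elim NSetE) simp
next
  case (RSet a e e' \<sigma>)
  then show ?case by (elim RSetE) simp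
next
  case (Seq c \<sigma> k \<sigma>' c' k' \<sigma>'')
  from Seq.prems show ?case
    by (rule SeqE) (metis Seq.IH)
next
  case (IfTrue \<sigma> b c k \<sigma>' c')
  from IfTrue.prems show ?case
    by (rule IfE) (use IfTrue.hyps in \<open>auto dest!: IfTrue.IH\<close>)
next
  case (IfFalse \<sigma> b c' k \<sigma>' c)
  from IfFalse.prems show ?case
    by (rule IfE) (use IfFalse.hyps in \<open>auto dest!: IfFalse.IH\<close>)
next
  case (WhileFalse \<sigma> b c)
  from WhileFalse.prems show ?case
    by (rule WhileE) (use WhileFalse.hyps in simp_all)
next
  case (WhileTrue \<sigma> b c k \<sigma>' k' \<sigma>'')
  from WhileTrue.prems show ?case
    by (rule WhileE) (use WhileTrue.hyps in \<open>auto dest!: WhileTrue.IH\<close>)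
qed

text \<open>
  The input consists of the number \<open>n\<close> of rules, which are named by the indices \<open>0, \<dots>, n - 1\<close>,
  and of the arrays of their runtimes and qualities; all other memory cells are initially 0. The
  output is the sequence of rules stored in the first \<open>len\<close> cells of the array \<open>out\<close>.
\<close>

definition input_mem :: "nat \<Rightarrow> (nat \<Rightarrow> nat) \<Rightarrow> (nat \<Rightarrow> real) \<Rightarrow> mem" where
  "input_mem n t q =
     \<lparr>nat_mem = (\<lambda>a i. if a = ''n'' \<and> i = 0 then n else 0),
      real_mem = (\<lambda>a i. if a = ''t'' \<and> i < n then real (t i)
                        else if a = ''q'' \<and> i < n then q i else 0)\<rparr>"

definition output_seq :: "mem \<Rightarrow> nat list" where
  "output_seq \<sigma> = map (nat_mem \<sigma> ''out'') [0..<nat_mem \<sigma> ''len'' 0]"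

end

theory Submission
  imports Defs
begin

text \<open>
  Summation by parts writes the value of a sequence as the sum of the quality increments, each
  weighted by the probability that the deadline comes after the completion of the rule in question.
  Rules that do not improve the quality only cause delay, so improving sequences suffice. They
  repeat no rule and finish before \<open>D\<close>, where the distribution function is linear; hence
  \<open>D V = D Q\<^sub>m - (\<Sum>i. t\<^sub>i (Q\<^sub>m - Q\<^bsub>i-1\<^esub>))\<close> with \<open>Q\<^sub>0 = 0\<close>. Appending a best rule never hurts, so
  \<open>Q\<^sub>m\<close> may be taken to be the maximal quality. What remains is a shortest path problem on the
  rules sorted by quality, where the cost of a step depends only on its two end points. It is
  solved without knowing \<open>D\<close>.
\<close>

section \<open>Optimal sequences as shortest paths\<close>

text \<open>Scaling by \<open>D\<close> keeps divisions out of the later estimates. The truncation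
  at 0 remains because a sequence that repeats rules may run past \<open>D\<close>.\<close>

lemma cdf_uniform_Icc:
  assumes "0 < D" "0 \<le> x"
  shows "D * (1 - cdf (uniform_measure lborel {0..D}) x) = max 0 (D - x)"
proof -
  have "{0..D} \<inter> {..x} = {0..min D x}"
    by auto
  then have "cdf (uniform_measure lborel {0..D}) x = min D x / D"
    using assms unfolding cdf_def by (subst measure_uniform_measure) auto
  then show ?thesis
    using assms by (auto simp: field_simps min_def max_def)
qed

text \<open>\<open>S\<close> is the survival function of the deadline, \<open>c\<close> the time
  elapsed and \<open>Q\<close> the best quality so far. With these accumulators the value becomes
  recursive in the list, whereas \<open>seq_value\<close> refers to prefixes by index.\<close>

primrec gain :: "(nat \<Rightarrow> real) \<Rightarrow> ('r \<Rightarrow> nat) \<Rightarrow> ('r \<Rightarrow> real) \<Rightarrow> nat \<Rightarrow> real \<Rightarrow> 'r list \<Rightarrow> real" where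
  "gain S t q c Q [] = 0"
| "gain S t q c Q (x # xs) =
     S (c + t x) * (max Q (q x) - Q) + gain S t q (c + t x) (max Q (q x)) xs"

text \<open>Removing the head turns \<open>c\<close> and \<open>Q\<close> into
  \<open>c + t x\<close> and \<open>max Q (q x)\<close>, so the induction needs both offsets. The
  extra summand is the boundary term of the summation by parts: the quality \<open>Q\<close> already
  in hand, weighted by the probability that the deadline comes after the first completion.\<close>

lemma seq_value_shifted:
  fixes P :: "real \<Rightarrow> real" and t :: "'r \<Rightarrow> nat" and q :: "'r \<Rightarrow> real"
  assumes "s \<noteq> []"
  shows "(\<Sum>i<length s.
           ((if Suc i = length s then 1 else P (real (c + (\<Sum>j\<le>Suc i. t (s ! j)))))
              - P (real (c + (\<Sum>j\<le>i. t (s ! j)))))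
           * max Q (Max ((\<lambda>j. q (s ! j)) ` {..i})))
         = gain (\<lambda>T. 1 - P (real T)) t q c Q s + Q * (1 - P (real (c + t (hd s))))"
  using assms
proof (induction s arbitrary: c Q)
  case Nil
  then show ?case by simp
next
  case (Cons x xs)
  show ?case
  proof (cases "xs = []")
    case True
    then show ?thesis by (simp add: algebra_simps)
  next
    case False
    have Max_Suc: "max Q (Max ((\<lambda>j. q ((x # xs) ! j)) ` {..Suc i})) =
        max (max Q (q x)) (Max ((\<lambda>j. q (xs ! j)) ` {..i}))" for i
    proof -
      have "(\<lambda>j. q ((x # xs) ! j)) ` {..Suc i} = insert (q x) ((\<lambda>j. q (xs ! j)) ` {..i})"
        by (simp add: atMost_Suc_eq_insert_0 image_image)
      then show ?thesis
        by (simp add: max.assoc)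
    qed
    have "0 < length xs" "xs ! 0 = hd xs"
      using False by (simp_all add: hd_conv_nth)
    then show ?thesis
      using Cons.IH[OF False, of "c + t x" "max Q (q x)"]
      by (simp add: sum.lessThan_Suc_shift sum.atMost_Suc_shift Max_Suc add.assoc
          del: sum.atMost_Suc sum.lessThan_Suc of_nat_add of_nat_sum cong: if_cong)
        (simp add: algebra_simps)
  qed
qed

text \<open>For \<open>Q = 0\<close> the boundary term vanishes, and the maximum with 0 changes
  nothing because qualities are nonnegative.\<close>

lemma seq_value_eq_gain:
  assumes "s \<noteq> []" "\<And>x. x \<in> set s \<Longrightarrow> 0 \<le> q x"
  shows "seq_value P t q s = gain (\<lambda>T. 1 - P (real T)) t q 0 0 s"
proof -
  have "max 0 (Max ((\<lambda>j. q (s ! j)) ` {..i})) = Max ((\<lambda>j. q (s ! j)) ` {..i})" if "i < length s" for i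
    using assms(2)[of "s ! i"] that by (intro max_absorb2) (auto simp: Max_ge_iff)
  with seq_value_shifted[OF assms(1), of P 0 t 0 q] show ?thesis
    unfolding seq_value_def by (simp del: of_nat_sum sum.atMost_Suc cong: sum.cong_simp if_cong)
qed

text \<open>A later start lowers every weight, while the quality increments are nonnegative and do
  not depend on \<open>c\<close>.\<close>

lemma gain_antimono:
  assumes "antimono S" "c \<le> c'"
  shows "gain S t q c' Q s \<le> gain S t q c Q s"
  using assms(2)
proof (induction s arbitrary: c c' Q)
  case (Cons x xs)
  have "S (c' + t x) \<le> S (c + t x)"
    using Cons.prems by (intro antimonoD[OF assms(1)]) simp
  with Cons show ?case
    by (auto intro!: add_mono mult_right_mono)
qed simp

section \<open>Paths through the ranks and their losses\<close>

text \<open>The test \<open>succ r < r\<close> ensures termination for arbitrary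
  \<open>succ\<close>; in the locale below, among the ranks up to \<open>n\<close>, it fails only at
  0. A step emits the rule of the rank it enters, so the start rank \<open>n\<close> emits
  nothing.\<close>

function rule_path :: "(nat \<Rightarrow> 'r) \<Rightarrow> (nat \<Rightarrow> nat) \<Rightarrow> nat \<Rightarrow> 'r list" where
  "rule_path rule succ r = (if succ r < r then rule (succ r) # rule_path rule succ (succ r) else [])"
  by auto
termination by (relation "Wellfounded.measure (\<lambda>(_, _, r). r)") auto

declare rule_path.simps [simp del]

text \<open>
  Rules are ranked by decreasing quality. Rank \<open>n\<close> stands for the state before any rule has
  completed, whence its level 0; \<open>B r\<close> is the least total loss of the steps from rank \<open>r\<close> to rank 0.
\<close>

locale ranked_rules =
  fixes n :: nat and t :: "nat \<Rightarrow> nat" and q :: "nat \<Rightarrow> real"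
    and rule :: "nat \<Rightarrow> nat" and level :: "nat \<Rightarrow> real"
    and B :: "nat \<Rightarrow> real" and succ :: "nat \<Rightarrow> nat"
  assumes n_pos: "0 < n"
    and rule_image: "rule ` {..<n} = {..<n}"
    and level_rule: "r < n \<Longrightarrow> level r = q (rule r)"
    and level_n: "level n = 0"
    and level_antimono: "r \<le> s \<Longrightarrow> s \<le> n \<Longrightarrow> level s \<le> level r"
    and B_0: "B 0 = 0"
    and B_le: "k < r \<Longrightarrow> r \<le> n \<Longrightarrow> B r \<le> real (t (rule k)) * (level 0 - level r) + B k"
    and succ_less: "0 < r \<Longrightarrow> r \<le> n \<Longrightarrow> succ r < r"
    and B_eq: "0 < r \<Longrightarrow> r \<le> n \<Longrightarrow>
      B r = real (t (rule (succ r))) * (level 0 - level r) + B (succ r)"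
begin

lemma rule_less: "r < n \<Longrightarrow> rule r < n"
  using rule_image by blast

text \<open>
  The last assumption says that all improving rules can still be run before \<open>D\<close>. Dropping
  non-improving rules keeps it invariant although the sequence may exceed \<open>D\<close> by repeating rules.
\<close>

lemma gain_le:
  fixes S :: "nat \<Rightarrow> real" and D :: real
  assumes S: "antimono S" "\<And>T. D * S T = max 0 (D - real T)" and D: "0 < D"
    and "set s \<subseteq> {..<n}" "r \<le> n"
    and "real c + (\<Sum>i | i < n \<and> level r < q i. real (t i)) \<le> D"
  shows "D * gain S t q c (level r) s \<le> (D - c) * (level 0 - level r) - B r"
  using assms(4-)
proof (induction s arbitrary: c r)
  case Nil
  show ?case
  \<comment> \<open>If a better rule exists, stopping is no better than a direct step to rank 0,
    because the best rule still fits before \<open>D\<close>.\<close>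
  proof (cases "level r < level 0")
    case True
    then have "0 < r"
      using le_neq_implies_less by fastforce
    have "rule 0 < n" "level 0 = q (rule 0)"
      using rule_less level_rule n_pos by auto
    then have "real (t (rule 0)) \<le> (\<Sum>i | i < n \<and> level r < q i. real (t i))"
      using True by (intro member_le_sum) auto
    then have "real (t (rule 0)) * (level 0 - level r) \<le> (D - c) * (level 0 - level r)"
      using Nil True by (intro mult_right_mono) auto
    with B_le[OF \<open>0 < r\<close> Nil(2)] show ?thesis
      by (simp add: B_0)
  next
    case False
    then have eq: "level r = level 0"
      using level_antimono[of 0 r] Nil by auto
    have "B r \<le> 0"
    proof (cases "r = 0")
      case False
      then show ?thesis using B_le[of 0 r] Nil by (simp add: B_0 eq)
    qed (simp add: B_0)
    then show ?thesis by (simp add: eq)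
  qed
next
  case (Cons x xs)
  then have xs: "set xs \<subseteq> {..<n}" and "x < n"
    by auto
  show ?case
  proof (cases "level r < q x")
    case False
    then have "gain S t q c (level r) (x # xs) = gain S t q (c + t x) (level r) xs"
      by simp
    also have "\<dots> \<le> gain S t q c (level r) xs"
      by (intro gain_antimono S) simp
    finally have "D * gain S t q c (level r) (x # xs) \<le> D * gain S t q c (level r) xs"
      by (rule mult_left_mono) (rule less_imp_le[OF D])
    also note Cons.IH[OF xs Cons.prems(2,3)]
    finally show ?thesis .
  next
    case True
    have "x \<in> rule ` {..<n}"
      using \<open>x < n\<close> by (simp add: rule_image)
    then obtain k where k: "k < n" "rule k = x"
      by blast
    then have lk: "level k = q x"
      by (simp add: level_rule)
    have "k < r"
      using True lk level_antimono[of r k] k by force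
    \<comment> \<open>Since \<open>q x = level k\<close>, the rule \<open>x\<close> counts among
      those above \<open>level r\<close> but not among those above \<open>level k\<close>. Moving to
      rank \<open>k\<close> thus frees at least the time \<open>t x\<close>.\<close>
    have "real (t x) + (\<Sum>i | i < n \<and> level k < q i. real (t i)) =
        (\<Sum>i \<in> insert x {i. i < n \<and> level k < q i}. real (t i))"
      by (simp add: lk)
    also have "\<dots> \<le> (\<Sum>i | i < n \<and> level r < q i. real (t i))"
      using True \<open>x < n\<close> by (intro sum_mono2) (auto simp: lk)
    finally have room: "real (t x) + (\<Sum>i | i < n \<and> level k < q i. real (t i)) \<le> D - c"
      using Cons.prems by simp
    then have "real (c + t x) + (\<Sum>i | i < n \<and> level k < q i. real (t i)) \<le> D"
      by simp
    from Cons.IH[OF xs _ this] k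
    have IH: "D * gain S t q (c + t x) (level k) xs \<le> (D - real (c + t x)) * (level 0 - level k) - B k"
      by simp
    have "0 \<le> D - real (c + t x)"
      using room sum_nonneg[of "{i. i < n \<and> level k < q i}" "\<lambda>i. real (t i)"] by simp
    then have "D * S (c + t x) = D - real (c + t x)"
      by (simp add: S)
    then have "D * gain S t q c (level r) (x # xs) =
        (D - real (c + t x)) * (level k - level r) + D * gain S t q (c + t x) (level k) xs"
      using True by (simp add: lk distrib_left mult.assoc[symmetric] max_absorb2)
    \<comment> \<open>The level differences add up to \<open>level 0 - level r\<close>, and
      \<open>t x\<close> times this sum is the loss of the step from \<open>r\<close> to
      \<open>k\<close>.\<close>
    with IH B_le[OF \<open>k < r\<close> Cons.prems(2)] k show ?thesis
      by (simp add: algebra_simps)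
  qed
qed

text \<open>Truncation at 0 only raises the weights and levels never fall along the path, so the
  linear weights give a lower bound. Along \<open>succ\<close> the recursion for \<open>B\<close>
  holds with equality, which yields the number that is the upper bound in
  \<open>gain_le\<close>.\<close>

lemma gain_path_ge:
  fixes S :: "nat \<Rightarrow> real" and D :: real
  assumes S: "\<And>T. D * S T = max 0 (D - real T)" and "r \<le> n"
  shows "(D - c) * (level 0 - level r) - B r \<le> D * gain S t q c (level r) (rule_path rule succ r)"
  using assms(2)
proof (induction r arbitrary: c rule: less_induct)
  case (less r)
  show ?case
  proof (cases "r = 0")
    case True
    then show ?thesis by (simp add: rule_path.simps B_0)
  next
    case False
    define k where "k = succ r"
    have k: "k < r" and B: "B r = real (t (rule k)) * (level 0 - level r) + B k"
      using False less.prems succ_less B_eq by (auto simp: k_def)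
    have le: "level r \<le> level k" "level k = q (rule k)"
      using level_antimono[of k r] level_rule[of k] k less.prems by auto
    have "(D - real (c + t (rule k))) * (level k - level r)
        \<le> D * S (c + t (rule k)) * (level k - level r)"
      using le by (intro mult_right_mono) (auto simp: S)
    moreover have "(D - real (c + t (rule k))) * (level 0 - level k) - B k
        \<le> D * gain S t q (c + t (rule k)) (level k) (rule_path rule succ k)"
      using less.IH[OF k, of "c + t (rule k)"] k less.prems by simp
    moreover have "rule_path rule succ r = rule k # rule_path rule succ k"
      using k by (subst rule_path.simps) (simp add: k_def)
    ultimately show ?thesis
      using B le by (simp add: algebra_simps max_absorb2)
  qed
qed

lemma path_in_sequences: "rule_path rule succ n \<in> sequences {..<n}"
proof -
  have "set (rule_path rule succ r) \<subseteq> {..<n}" if "r \<le> n" for r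
    using that
  proof (induction r rule: less_induct)
    case (less r)
    then show ?case
      using rule_less by (subst rule_path.simps) auto
  qed
  moreover have "rule_path rule succ n \<noteq> []"
    using succ_less[of n] n_pos by (subst rule_path.simps) simp
  ultimately show ?thesis
    by (simp add: sequences_def)
qed

text \<open>At rank \<open>n\<close> and time 0 the bounds of \<open>gain_le\<close> and
  \<open>gain_path_ge\<close> coincide. The improving rules fit before \<open>D\<close> because even
  all rules together take less time.\<close>

lemma optimal_path:
  assumes q: "\<And>i. i < n \<Longrightarrow> 0 \<le> q i"
    and P: "P = cdf (uniform_measure lborel {0..D})" and D: "real (\<Sum>i<n. t i) < D"
  shows "optimal_sequence {..<n} P t q (rule_path rule succ n)"
  unfolding optimal_sequence_def
proof (intro conjI ballI path_in_sequences)
  fix s assume s: "s \<in> sequences {..<n}"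
  define S where "S = (\<lambda>T. 1 - P (real T))"
  have "0 < D"
    using D of_nat_0_le_iff[of "\<Sum>i<n. t i", where 'a = real] by linarith
  then have S: "D * S T = max 0 (D - real T)" for T
    by (simp add: S_def P cdf_uniform_Icc)
  have "antimono S"
  proof (rule antimonoI)
    fix x y :: nat assume "x \<le> y"
    then have "D * S y \<le> D * S x" by (simp add: S)
    then show "S y \<le> S x" using \<open>0 < D\<close> by simp
  qed
  have "(\<Sum>i | i < n \<and> level n < q i. real (t i)) \<le> (\<Sum>i<n. real (t i))"
    by (intro sum_mono2) auto
  then have "D * gain S t q 0 (level n) s \<le> (D - real 0) * (level 0 - level n) - B n"
    using s D by (intro gain_le S \<open>antimono S\<close> \<open>0 < D\<close>) (auto simp: sequences_def)
  also have "\<dots> \<le> D * gain S t q 0 (level n) (rule_path rule succ n)"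
    by (rule gain_path_ge[OF S]) simp
  finally have "gain S t q 0 0 s \<le> gain S t q 0 0 (rule_path rule succ n)"
    using \<open>0 < D\<close> by (simp add: level_n)
  moreover have "seq_value P t q s' = gain S t q 0 0 s'" if "s' \<in> sequences {..<n}" for s'
    using that q unfolding S_def by (intro seq_value_eq_gain) (auto simp: sequences_def)
  ultimately show "seq_value P t q s \<le> seq_value P t q (rule_path rule succ n)"
    using s path_in_sequences by simp
qed

end

section \<open>Running times\<close>

text \<open>Existence of an execution includes termination, and since \<open>exec\<close> is
  deterministic it describes the only one. A bound in place of the exact count makes the estimates
  easy to compose.\<close>

definition runs :: "(real \<Rightarrow> real) \<Rightarrow> com \<Rightarrow> mem \<Rightarrow> nat \<Rightarrow> (mem \<Rightarrow> bool) \<Rightarrow> bool" where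
  "runs P c \<sigma> K Q \<longleftrightarrow> (\<exists>k \<tau>. exec P c \<sigma> k \<tau> \<and> k \<le> K \<and> Q \<tau>)"

lemma runs_Seq:
  assumes "runs P c \<sigma> K R" "\<And>\<tau>. R \<tau> \<Longrightarrow> runs P d \<tau> L Q" "K + L \<le> M"
  shows "runs P (Seq c d) \<sigma> M Q"
proof -
  obtain k \<tau> where "exec P c \<sigma> k \<tau>" "k \<le> K" "R \<tau>"
    using assms(1) unfolding runs_def by blast
  moreover obtain l \<rho> where "exec P d \<tau> l \<rho>" "l \<le> L" "Q \<rho>"
    using assms(2) \<open>R \<tau>\<close> unfolding runs_def by blast
  ultimately show ?thesis
    unfolding runs_def using exec.Seq assms(3) by (meson add_mono order_trans)
qed

text \<open>For loop-free programs the final memory and a cost bound are computed by recursion on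
  the syntax, so that their correctness becomes a matter of simplification.\<close>

primrec straight :: "com \<Rightarrow> bool" where
  "straight Skip \<longleftrightarrow> True"
| "straight (NSet a e e') \<longleftrightarrow> True"
| "straight (RSet a e e') \<longleftrightarrow> True"
| "straight (Seq c d) \<longleftrightarrow> straight c \<and> straight d"
| "straight (If b c d) \<longleftrightarrow> straight c \<and> straight d"
| "straight (While b c) \<longleftrightarrow> False"

text \<open>The values of \<open>final\<close> and \<open>max_cost\<close> on loops are irrelevant: they are only used for straight-line programs.\<close>

primrec final :: "(real \<Rightarrow> real) \<Rightarrow> com \<Rightarrow> mem \<Rightarrow> mem" where
  "final P Skip \<sigma> = \<sigma>"
| "final P (NSet a e e') \<sigma> = nat_upd a (nval \<sigma> e) (nval \<sigma> e') \<sigma>"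
| "final P (RSet a e e') \<sigma> = real_upd a (nval \<sigma> e) (rval P \<sigma> e') \<sigma>"
| "final P (Seq c d) \<sigma> = final P d (final P c \<sigma>)"
| "final P (If b c d) \<sigma> = (if bval P \<sigma> b then final P c \<sigma> else final P d \<sigma>)"
| "final P (While b c) \<sigma> = \<sigma>"

primrec max_cost :: "com \<Rightarrow> nat" where
  "max_cost Skip = 1"
| "max_cost (NSet a e e') = 1 + ncost e + ncost e'"
| "max_cost (RSet a e e') = 1 + ncost e + rcost e'"
| "max_cost (Seq c d) = max_cost c + max_cost d"
| "max_cost (If b c d) = 1 + bcost b + max (max_cost c) (max_cost d)"
| "max_cost (While b c) = 0"

lemma exec_straight:
  "straight c \<Longrightarrow> \<exists>k \<le> max_cost c. exec P c \<sigma> k (final P c \<sigma>)"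
proof (induction c arbitrary: \<sigma>)
  case (Seq c d)
  then have "straight c" "straight d"
    by simp_all
  with Seq.IH obtain k l where k: "k \<le> max_cost c" "exec P c \<sigma> k (final P c \<sigma>)"
    and l: "l \<le> max_cost d" "exec P d (final P c \<sigma>) l (final P d (final P c \<sigma>))"
    by metis
  show ?case
    using exec.Seq[OF k(2) l(2)] k(1) l(1) by (intro exI[of _ "k + l"]) simp
next
  case (If b c d)
  then have cd: "straight c" "straight d"
    by simp_all
  show ?case
  proof (cases "bval P \<sigma> b")
    case True
    obtain k where k: "k \<le> max_cost c" "exec P c \<sigma> k (final P c \<sigma>)"
      using If.IH(1) cd by blast
    show ?thesis
      using exec.IfTrue[OF True k(2), of d] k(1) True by (intro exI[of _ "1 + bcost b + k"]) simp
  next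
    case False
    obtain k where k: "k \<le> max_cost d" "exec P d \<sigma> k (final P d \<sigma>)"
      using If.IH(2) cd by blast
    show ?thesis
      using exec.IfFalse[OF False k(2), of c] k(1) False by (intro exI[of _ "1 + bcost b + k"]) simp
  qed
next
  case Skip
  show ?case using exec.Skip by fastforce
next
  case (NSet a e e')
  show ?case using exec.NSet by fastforce
next
  case (RSet a e e')
  show ?case using exec.RSet by fastforce
qed simp

lemma runs_straight:
  assumes "straight c" "max_cost c \<le> K" "Q (final P c \<sigma>)"
  shows "runs P c \<sigma> K Q"
  using exec_straight[OF assms(1)] assms(2,3) unfolding runs_def by (meson order_trans)

text \<open>\<open>f\<close> bounds the number of iterations, since it falls with each one. The
  summand outside the product pays for the test that ends the loop.\<close>

lemma runs_While:
  fixes f :: "mem \<Rightarrow> nat"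
  assumes "Inv \<sigma>"
    and step: "\<And>\<tau>. Inv \<tau> \<Longrightarrow> bval P \<tau> b \<Longrightarrow> runs P c \<tau> K (\<lambda>\<rho>. Inv \<rho> \<and> f \<rho> < f \<tau>)"
    and exit: "\<And>\<tau>. Inv \<tau> \<Longrightarrow> \<not> bval P \<tau> b \<Longrightarrow> Q \<tau>"
    and M: "f \<sigma> * (1 + bcost b + K) + (1 + bcost b) \<le> M"
  shows "runs P (While b c) \<sigma> M Q"
proof -
  have "runs P (While b c) \<sigma> (f \<sigma> * (1 + bcost b + K) + (1 + bcost b)) Q"
    using assms(1)
  proof (induction "f \<sigma>" arbitrary: \<sigma> rule: less_induct)
    case less
    show ?case
    proof (cases "bval P \<sigma> b")
      case True
      obtain k \<rho> where \<rho>: "exec P c \<sigma> k \<rho>" "k \<le> K" "Inv \<rho>" "f \<rho> < f \<sigma>"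
        using step[OF less.prems True] unfolding runs_def by blast
      obtain l \<tau> where \<tau>: "exec P (While b c) \<rho> l \<tau>" "Q \<tau>"
          "l \<le> f \<rho> * (1 + bcost b + K) + (1 + bcost b)"
        using less.hyps[OF \<rho>(4,3)] unfolding runs_def by blast
      have "Suc (f \<rho>) * (1 + bcost b + K) \<le> f \<sigma> * (1 + bcost b + K)"
        using \<rho> by (intro mult_right_mono) auto
      then have "1 + bcost b + k + l \<le> f \<sigma> * (1 + bcost b + K) + (1 + bcost b)"
        using \<tau> \<rho> by simp
      then show ?thesis
        unfolding runs_def using exec.WhileTrue[OF True \<rho>(1) \<tau>(1)] \<tau>(2) by blast
    next
      case False
      then show ?thesis
        unfolding runs_def using exec.WhileFalse[OF False] exit[OF less.prems False]
        by (intro exI[of _ "1 + bcost b"] exI[of _ \<sigma>]) simp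
    qed
  qed
  then show ?thesis
    using M unfolding runs_def by (meson order_trans)
qed

abbreviation nvar :: "string \<Rightarrow> nexp" where
  "nvar a \<equiv> NGet a (NConst 0)"

definition for_loop :: "string \<Rightarrow> nexp \<Rightarrow> nexp \<Rightarrow> com \<Rightarrow> com" where
  "for_loop i e e' c =
     Seq (NSet i (NConst 0) e)
       (While (NLess (nvar i) e') (Seq c (NSet i (NConst 0) (NAdd (nvar i) (NConst 1)))))"

text \<open>\<open>Inv j\<close> describes the memory at the loop head, so the body must establish
  it for the memory after the increment. The bound \<open>e'\<close> is evaluated at each test,
  hence the invariant fixes its value. An iteration costs \<open>K\<close> for the body, 6 for the
  increment and \<open>4 + ncost e'\<close> for the test.\<close>

lemma runs_for_loop:
  assumes start: "Inv l (nat_upd i 0 l \<sigma>)" and e: "nval \<sigma> e = l" and "l \<le> m"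
    and inv: "\<And>j \<tau>. Inv j \<tau> \<Longrightarrow> nat_mem \<tau> i 0 = j \<and> nval \<tau> e' = m"
    and step: "\<And>j \<tau>. Inv j \<tau> \<Longrightarrow> j < m \<Longrightarrow>
      runs P c \<tau> K (\<lambda>\<rho>. nat_mem \<rho> i 0 = j \<and> Inv (Suc j) (nat_upd i 0 (Suc j) \<rho>))"
    and exit: "\<And>\<tau>. Inv m \<tau> \<Longrightarrow> Q \<tau>"
    and M: "m * (10 + ncost e' + K) + ncost e + ncost e' + 6 \<le> M"
  shows "runs P (for_loop i e e' c) \<sigma> M Q"
  unfolding for_loop_def
proof (rule runs_Seq)
  show "runs P (NSet i (NConst 0) e) \<sigma> (2 + ncost e) (Inv l)"
    using start e by (intro runs_straight) auto
  fix \<tau>0 assume "Inv l \<tau>0"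
  show "runs P (While (NLess (nvar i) e') (Seq c (NSet i (NConst 0) (NAdd (nvar i) (NConst 1)))))
    \<tau>0 (m * (10 + ncost e' + K) + ncost e' + 4) Q"
  proof (rule runs_While[where Inv = "\<lambda>\<tau>. \<exists>j \<le> m. Inv j \<tau>" and f = "\<lambda>\<tau>. m - nat_mem \<tau> i 0" and K = "K + 6"])
    show "\<exists>j \<le> m. Inv j \<tau>0"
      using \<open>Inv l \<tau>0\<close> \<open>l \<le> m\<close> by blast
  next
    fix \<tau> assume "\<exists>j \<le> m. Inv j \<tau>" "bval P \<tau> (NLess (nvar i) e')"
    then obtain j where j: "Inv j \<tau>" "j < m" "nat_mem \<tau> i 0 = j"
      using inv by fastforce
    show "runs P (Seq c (NSet i (NConst 0) (NAdd (nvar i) (NConst 1)))) \<tau> (K + 6)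
        (\<lambda>\<rho>. (\<exists>j \<le> m. Inv j \<rho>) \<and> m - nat_mem \<rho> i 0 < m - nat_mem \<tau> i 0)"
      using step[OF j(1,2)]
    proof (rule runs_Seq)
      fix \<rho> :: mem assume \<rho>: "nat_mem \<rho> i 0 = j \<and> Inv (Suc j) (nat_upd i 0 (Suc j) \<rho>)"
      then have "\<exists>k \<le> m. Inv k (nat_upd i 0 (Suc j) \<rho>)"
        using j by (intro exI[of _ "Suc j"]) auto
      then show "runs P (NSet i (NConst 0) (NAdd (nvar i) (NConst 1))) \<rho> 6
          (\<lambda>\<rho>. (\<exists>j \<le> m. Inv j \<rho>) \<and> m - nat_mem \<rho> i 0 < m - nat_mem \<tau> i 0)"
        using \<rho> j by (intro runs_straight) (auto simp: nat_upd_def)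
    qed simp
  next
    fix \<tau> assume "\<exists>j \<le> m. Inv j \<tau>" "\<not> bval P \<tau> (NLess (nvar i) e')"
    then show "Q \<tau>"
      using inv exit by (metis bval.simps(1) le_neq_implies_less nval.simps(1,2))
  next
    have "(m - nat_mem \<tau>0 i 0) * (10 + ncost e' + K) \<le> m * (10 + ncost e' + K)"
      by (intro mult_right_mono) auto
    then show "(m - nat_mem \<tau>0 i 0) * (1 + bcost (NLess (nvar i) e') + (K + 6)) +
        (1 + bcost (NLess (nvar i) e')) \<le> m * (10 + ncost e' + K) + ncost e' + 4"
      by (simp add: algebra_simps)
  qed
qed (use M in simp)

lemma mem_upd [simp]:
  "nat_mem (nat_upd a i v \<sigma>) = (nat_mem \<sigma>)(a := (nat_mem \<sigma> a)(i := v))"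
  "real_mem (nat_upd a i v \<sigma>) = real_mem \<sigma>"
  "nat_mem (real_upd a i x \<sigma>) = nat_mem \<sigma>"
  "real_mem (real_upd a i x \<sigma>) = (real_mem \<sigma>)(a := (real_mem \<sigma> a)(i := x))"
  by (simp_all add: nat_upd_def real_upd_def)

section \<open>The program\<close>

text \<open>The state after \<open>r\<close> rounds: each chosen rule was a best one among those not
  chosen before it. Unlike mere sortedness of the prefix, this also compares with the rules still to
  be chosen.\<close>

definition selected :: "nat \<Rightarrow> (nat \<Rightarrow> real) \<Rightarrow> nat \<Rightarrow> (nat \<Rightarrow> nat) \<Rightarrow> bool" where
  "selected n q r rule \<longleftrightarrow> inj_on rule {..<r} \<and> rule ` {..<r} \<subseteq> {..<n} \<and>
     (\<forall>k<r. \<forall>i<n. i \<notin> rule ` {..<k} \<longrightarrow> q i \<le> q (rule k))"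

lemma selected_Suc:
  assumes "selected n q r rule" "b < n" "b \<notin> rule ` {..<r}"
    and "\<And>i. i < n \<Longrightarrow> i \<notin> rule ` {..<r} \<Longrightarrow> q i \<le> q b"
  shows "selected n q (Suc r) (rule(r := b))"
proof -
  have *: "(rule(r := b)) ` {..<k} = rule ` {..<k}" if "k \<le> r" for k
    using that by auto
  have "inj_on (rule(r := b)) {..<r}"
    using assms(1) unfolding selected_def by (simp add: inj_on_def)
  then have "inj_on (rule(r := b)) {..<Suc r}"
    using assms(3) *[of r] by (simp add: lessThan_Suc)
  moreover have "(rule(r := b)) ` {..<Suc r} \<subseteq> {..<n}"
  proof -
    have "(rule(r := b)) ` {..<Suc r} = insert b (rule ` {..<r})"
      by (auto simp: lessThan_Suc)
    then show ?thesis
      using assms(1,2) by (simp add: selected_def)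
  qed
  moreover have "q i \<le> q ((rule(r := b)) k)"
    if "k < Suc r" "i < n" "i \<notin> (rule(r := b)) ` {..<k}" for i k
  proof -
    have "i \<notin> rule ` {..<k}"
      using that *[of k] by simp
    then show ?thesis
      using assms(1,4) that by (cases "k = r") (auto simp: selected_def)
  qed
  ultimately show ?thesis
    unfolding selected_def by blast
qed

lemma selected_image:
  assumes "selected n q n rule"
  shows "rule ` {..<n} = {..<n}"
  using assms unfolding selected_def by (simp add: endo_inj_surj)

text \<open>By injectivity the rule of rank \<open>s\<close> was still available when rank
  \<open>r\<close> was filled.\<close>

lemma selected_antimono:
  assumes "selected n q n rule" "r \<le> s" "s < n"
  shows "q (rule s) \<le> q (rule r)"
proof -
  have "rule s \<notin> rule ` {..<r}"
    using assms unfolding selected_def by (auto dest: inj_onD)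
  moreover have "rule s < n"
    using selected_image[OF assms(1)] assms(3) by blast
  ultimately show ?thesis
    using assms unfolding selected_def by (meson le_less_trans)
qed

text \<open>
  Initially \<open>b = n\<close>, and cell \<open>n\<close> of the quality array is 0, so that any unmarked rule replaces it.
\<close>

definition select_prog :: com where
  "select_prog =
     for_loop ''j'' (NConst 0) (nvar ''n'')
       (If (BAnd (NEq (NGet ''mark'' (nvar ''j'')) (NConst 0))
              (BNot (RLess (RGet ''q'' (nvar ''j'')) (RGet ''q'' (nvar ''b'')))))
          (NSet ''b'' (NConst 0) (nvar ''j''))
          Skip)"

lemma runs_select_prog:
  fixes \<sigma> :: mem
  defines "q \<equiv> real_mem \<sigma> ''q''" and "mark \<equiv> nat_mem \<sigma> ''mark''"
  assumes n: "nat_mem \<sigma> ''n'' 0 = n" and b: "nat_mem \<sigma> ''b'' 0 = n"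
    and q_n: "q n = 0" and q: "\<And>i. i < n \<Longrightarrow> 0 \<le> q i"
    and ex: "\<exists>i<n. mark i = 0"
  shows "runs P select_prog \<sigma> (112 * n + 9)
    (\<lambda>\<tau>. real_mem \<tau> = real_mem \<sigma> \<and> (\<forall>a. a \<notin> {''b'', ''j''} \<longrightarrow> nat_mem \<tau> a = nat_mem \<sigma> a) \<and>
       (let b = nat_mem \<tau> ''b'' 0
        in b < n \<and> mark b = 0 \<and> (\<forall>i<n. mark i = 0 \<longrightarrow> q i \<le> q b)))"
proof -
  \<comment> \<open>\<open>b = n\<close> means that no unmarked rule has been met so far; otherwise
    \<open>b\<close> is a best one among those before \<open>j\<close>.\<close>
  define Inv where "Inv = (\<lambda>j (\<tau> :: mem). nat_mem \<tau> ''j'' 0 = j \<and> real_mem \<tau> = real_mem \<sigma> \<and>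
    (\<forall>a. a \<notin> {''b'', ''j''} \<longrightarrow> nat_mem \<tau> a = nat_mem \<sigma> a) \<and>
    (let b = nat_mem \<tau> ''b'' 0
     in (if b = n then \<forall>i<j. mark i \<noteq> 0 else b < n \<and> mark b = 0) \<and>
        (\<forall>i<j. mark i = 0 \<longrightarrow> q i \<le> q b)))"
  show ?thesis
    unfolding select_prog_def
  proof (rule runs_for_loop[where Inv = Inv and l = 0 and m = n and K = 100])
    show "Inv 0 (nat_upd ''j'' 0 0 \<sigma>)"
      by (simp add: Inv_def b)
  next
    fix j \<tau> assume "Inv j \<tau>"
    then show "nat_mem \<tau> ''j'' 0 = j \<and> nval \<tau> (nvar ''n'') = n"
      by (simp add: Inv_def n)
  next
    fix j \<tau> assume inv: "Inv j \<tau>" and "j < n"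
    then have "0 \<le> q j" by (simp add: q)
    have [simp]: "real_mem \<tau> ''q'' = q" "nat_mem \<tau> ''mark'' = mark" "nat_mem \<tau> ''j'' 0 = j"
      using inv by (simp_all add: Inv_def q_def mark_def)
    have frame: "real_mem \<tau> = real_mem \<sigma>" "\<forall>a. a \<notin> {''b'', ''j''} \<longrightarrow> nat_mem \<tau> a = nat_mem \<sigma> a"
      using inv by (simp_all add: Inv_def)
    show "runs P (If (BAnd (NEq (NGet ''mark'' (nvar ''j'')) (NConst 0))
              (BNot (RLess (RGet ''q'' (nvar ''j'')) (RGet ''q'' (nvar ''b'')))))
          (NSet ''b'' (NConst 0) (nvar ''j''))
          Skip) \<tau> 100 (\<lambda>\<rho>. nat_mem \<rho> ''j'' 0 = j \<and> Inv (Suc j) (nat_upd ''j'' 0 (Suc j) \<rho>))"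
      (is "runs P ?step _ _ _")
    proof (rule runs_straight)
      define b where "b = nat_mem \<tau> ''b'' 0"
      \<comment> \<open>Ties replace the candidate, so even an unmarked rule of quality 0 displaces
        the initial \<open>n\<close>.\<close>
      define c where "c = (if mark j = 0 \<and> \<not> q j < q b then j else b)"
      have b: "if b = n then \<forall>i<j. mark i \<noteq> 0 else b < n \<and> mark b = 0"
        using inv by (simp add: Inv_def Let_def b_def)
      have le_b: "q i \<le> q b" if "i < j" "mark i = 0" for i
        using inv that by (simp add: Inv_def Let_def b_def)
      have "if c = n then \<forall>i<Suc j. mark i \<noteq> 0 else c < n \<and> mark c = 0"
        using b \<open>j < n\<close> \<open>0 \<le> q j\<close> q_n by (auto simp: c_def less_Suc_eq)
      moreover have "q i \<le> q c" if "i < Suc j" "mark i = 0" for i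
        using le_b[of i] that by (cases "i = j") (auto simp: c_def)
      ultimately have "Inv (Suc j) (nat_upd ''j'' 0 (Suc j) (nat_upd ''b'' 0 c \<tau>))"
        using frame by (simp add: Inv_def Let_def)
      moreover have final_step: "final P ?step \<tau> = nat_upd ''b'' 0 c \<tau>"
        by (simp add: c_def b_def nat_upd_def)
      ultimately show "nat_mem (final P ?step \<tau>) ''j'' 0 = j \<and>
          Inv (Suc j) (nat_upd ''j'' 0 (Suc j) (final P ?step \<tau>))"
        unfolding final_step by simp
    qed simp_all
  next
    fix \<tau> assume "Inv n \<tau>"
    then show "real_mem \<tau> = real_mem \<sigma> \<and> (\<forall>a. a \<notin> {''b'', ''j''} \<longrightarrow> nat_mem \<tau> a = nat_mem \<sigma> a) \<and>
       (let b = nat_mem \<tau> ''b'' 0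
        in b < n \<and> mark b = 0 \<and> (\<forall>i<n. mark i = 0 \<longrightarrow> q i \<le> q b))"
      using ex by (auto simp: Inv_def Let_def split: if_splits)
  qed simp_all
qed

text \<open>Selection sort stays within quadratic time. The final assignment lets rank
  \<open>n\<close> point to cell \<open>n\<close> of the quality array, which holds 0, so that the
  loss computation can treat the start state like any other rank.\<close>

definition sort_prog :: com where
  "sort_prog =
     Seq (for_loop ''i'' (NConst 0) (nvar ''n'')
            (Seq (NSet ''b'' (NConst 0) (nvar ''n''))
              (Seq select_prog
                (Seq (NSet ''mark'' (nvar ''b'') (NConst 1))
                  (NSet ''rule'' (nvar ''i'') (nvar ''b''))))))
       (NSet ''rule'' (nvar ''n'') (nvar ''n''))"

lemma runs_sort_prog:
  fixes \<sigma> :: mem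
  defines "q \<equiv> real_mem \<sigma> ''q''"
  assumes n: "nat_mem \<sigma> ''n'' 0 = n" and mark: "nat_mem \<sigma> ''mark'' = (\<lambda>_. 0)"
    and q_n: "q n = 0" and q: "\<And>i. i < n \<Longrightarrow> 0 \<le> q i"
  shows "runs P sort_prog \<sigma> (n * (112 * n + 35) + 14)
    (\<lambda>\<tau>. real_mem \<tau> = real_mem \<sigma> \<and> nat_mem \<tau> ''n'' 0 = n \<and> nat_mem \<tau> ''len'' = nat_mem \<sigma> ''len'' \<and>
       selected n q n (nat_mem \<tau> ''rule'') \<and> nat_mem \<tau> ''rule'' n = n)"
proof -
  define Inv where "Inv = (\<lambda>r (\<tau> :: mem). nat_mem \<tau> ''i'' 0 = r \<and> real_mem \<tau> = real_mem \<sigma> \<and>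
    nat_mem \<tau> ''n'' 0 = n \<and> nat_mem \<tau> ''len'' = nat_mem \<sigma> ''len'' \<and>
    selected n q r (nat_mem \<tau> ''rule'') \<and>
    (\<forall>i. nat_mem \<tau> ''mark'' i = 0 \<longleftrightarrow> i \<notin> nat_mem \<tau> ''rule'' ` {..<r}))"
  show ?thesis
    unfolding sort_prog_def
  proof (rule runs_Seq)
    show "runs P (for_loop ''i'' (NConst 0) (nvar ''n'')
            (Seq (NSet ''b'' (NConst 0) (nvar ''n''))
              (Seq select_prog
                (Seq (NSet ''mark'' (nvar ''b'') (NConst 1))
                  (NSet ''rule'' (nvar ''i'') (nvar ''b''))))))
      \<sigma> (n * (112 * n + 35) + 9) (Inv n)"
    proof (rule runs_for_loop[where Inv = Inv and l = 0 and m = n and K = "112 * n + 23"])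
      show "Inv 0 (nat_upd ''i'' 0 0 \<sigma>)"
        by (simp add: Inv_def n mark selected_def)
    next
      fix r \<tau> assume "Inv r \<tau>"
      then show "nat_mem \<tau> ''i'' 0 = r \<and> nval \<tau> (nvar ''n'') = n"
        by (simp add: Inv_def)
    next
      fix r \<tau> assume inv: "Inv r \<tau>" and "r < n"
      \<comment> \<open>Only \<open>r < n\<close> rules are taken, so by counting an unmarked one
        remains.\<close>
      have "card (nat_mem \<tau> ''rule'' ` {..<r}) < card {..<n}"
        using \<open>r < n\<close> card_image_le[of "{..<r}" "nat_mem \<tau> ''rule''"] by simp
      then have "\<not> {..<n} \<subseteq> nat_mem \<tau> ''rule'' ` {..<r}"
        by (meson card_mono finite_imageI finite_lessThan leD)
      then have ex: "\<exists>i<n. nat_mem \<tau> ''mark'' i = 0"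
        using inv by (auto simp: Inv_def)
      show "runs P (Seq (NSet ''b'' (NConst 0) (nvar ''n''))
              (Seq select_prog
                (Seq (NSet ''mark'' (nvar ''b'') (NConst 1))
                  (NSet ''rule'' (nvar ''i'') (nvar ''b'')))))
          \<tau> (112 * n + 23) (\<lambda>\<rho>. nat_mem \<rho> ''i'' 0 = r \<and> Inv (Suc r) (nat_upd ''i'' 0 (Suc r) \<rho>))"
      proof (rule runs_Seq)
        show "runs P (NSet ''b'' (NConst 0) (nvar ''n'')) \<tau> 4
            (\<lambda>\<rho>. \<rho> = nat_upd ''b'' 0 n \<tau>)"
          using inv by (intro runs_straight) (auto simp: Inv_def)
        fix \<tau>1 assume \<tau>1: "\<tau>1 = nat_upd ''b'' 0 n \<tau>"
        have "real_mem \<tau>1 ''q'' = q" "nat_mem \<tau>1 ''n'' 0 = n" "nat_mem \<tau>1 ''b'' 0 = n"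
          "\<exists>i<n. nat_mem \<tau>1 ''mark'' i = 0"
          using inv ex by (simp_all add: Inv_def q_def \<tau>1)
        note sel = runs_select_prog[of \<tau>1 n P, unfolded this(1), OF this(2,3) q_n q this(4)]
        show "runs P (Seq select_prog
                (Seq (NSet ''mark'' (nvar ''b'') (NConst 1))
                  (NSet ''rule'' (nvar ''i'') (nvar ''b''))))
          \<tau>1 (112 * n + 19) (\<lambda>\<rho>. nat_mem \<rho> ''i'' 0 = r \<and> Inv (Suc r) (nat_upd ''i'' 0 (Suc r) \<rho>))"
        proof (rule runs_Seq[OF sel])
          fix \<tau>2 :: mem assume \<tau>2: "real_mem \<tau>2 = real_mem \<tau>1 \<and>
            (\<forall>a. a \<notin> {''b'', ''j''} \<longrightarrow> nat_mem \<tau>2 a = nat_mem \<tau>1 a) \<and>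
            (let b = nat_mem \<tau>2 ''b'' 0 in b < n \<and> nat_mem \<tau>1 ''mark'' b = 0 \<and>
              (\<forall>i<n. nat_mem \<tau>1 ''mark'' i = 0 \<longrightarrow> q i \<le> q b))"
          define b where "b = nat_mem \<tau>2 ''b'' 0"
          have b: "b < n" "b \<notin> nat_mem \<tau> ''rule'' ` {..<r}"
            "\<And>i. i < n \<Longrightarrow> i \<notin> nat_mem \<tau> ''rule'' ` {..<r} \<Longrightarrow> q i \<le> q b"
            using \<tau>2 inv by (simp_all add: Let_def b_def \<tau>1 Inv_def)
          have sel_Suc: "selected n q (Suc r) ((nat_mem \<tau> ''rule'')(r := b))"
            using inv b by (intro selected_Suc) (auto simp: Inv_def)
          have image_Suc: "(nat_mem \<tau> ''rule'')(r := b) ` {..<Suc r} = insert b (nat_mem \<tau> ''rule'' ` {..<r})"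
            by (auto simp: lessThan_Suc)
          have "nat_mem \<tau>2 a = nat_mem \<tau> a" if "a \<notin> {''b'', ''j''}" for a
            using \<tau>2 that by (simp add: \<tau>1)
          then have frame: "nat_mem \<tau>2 ''n'' = nat_mem \<tau> ''n''" "nat_mem \<tau>2 ''i'' = nat_mem \<tau> ''i''"
            "nat_mem \<tau>2 ''len'' = nat_mem \<tau> ''len''" "nat_mem \<tau>2 ''rule'' = nat_mem \<tau> ''rule''"
            "nat_mem \<tau>2 ''mark'' = nat_mem \<tau> ''mark''" "real_mem \<tau>2 = real_mem \<tau>"
            using \<tau>2 by (simp_all add: \<tau>1)
          show "runs P (Seq (NSet ''mark'' (nvar ''b'') (NConst 1))
                  (NSet ''rule'' (nvar ''i'') (nvar ''b'')))
              \<tau>2 10 (\<lambda>\<rho>. nat_mem \<rho> ''i'' 0 = r \<and> Inv (Suc r) (nat_upd ''i'' 0 (Suc r) \<rho>))"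
            using inv sel_Suc image_Suc
            by (intro runs_straight) (simp_all add: Inv_def frame b_def[symmetric])
        next
          show "112 * n + 9 + 10 \<le> 112 * n + (19::nat)" by simp
        qed
      qed simp
    qed simp_all
  next
    fix \<tau> assume inv: "Inv n \<tau>"
    have "selected n q n ((nat_mem \<tau> ''rule'')(n := n))"
    proof -
      have "(nat_mem \<tau> ''rule'')(n := n) ` {..<k} = nat_mem \<tau> ''rule'' ` {..<k}" if "k \<le> n" for k
        using that by auto
      then show ?thesis
        using inv unfolding Inv_def selected_def by (auto simp: inj_on_def)
    qed
    then show "runs P (NSet ''rule'' (nvar ''n'') (nvar ''n'')) \<tau> 5
      (\<lambda>\<tau>. real_mem \<tau> = real_mem \<sigma> \<and> nat_mem \<tau> ''n'' 0 = n \<and> nat_mem \<tau> ''len'' = nat_mem \<sigma> ''len'' \<and>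
         selected n q n (nat_mem \<tau> ''rule'') \<and> nat_mem \<tau> ''rule'' n = n)"
      using inv by (intro runs_straight) (auto simp: Inv_def)
  qed simp
qed

section \<open>Dynamic program for the least losses\<close>

text \<open>While the rule of rank \<open>e\<close> runs, the quality in hand is still that of rank
  \<open>i\<close>, so each unit of time costs the distance from there to the best quality. The
  losses from \<open>e\<close> onwards are added.\<close>

definition loss_exp :: "nexp \<Rightarrow> rexp" where
  "loss_exp e =
     RAdd (RMul (RGet ''t'' (NGet ''rule'' e))
             (RSub (RGet ''q'' (NGet ''rule'' (NConst 0))) (RGet ''q'' (NGet ''rule'' (nvar ''i'')))))
       (RGet ''B'' e)"

text \<open>Ranks are treated in increasing order, so the entries of smaller ranks are final when
  read. Candidate 0 initialises the minimum, hence the inner loop starts at 1; the outer loop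
  includes \<open>n\<close>, the start state. \<open>REval\<close> does not occur, since the losses
  do not involve \<open>D\<close>.\<close>

definition loss_prog :: com where
  "loss_prog =
     for_loop ''i'' (NConst 1) (NAdd (nvar ''n'') (NConst 1))
       (Seq (Seq (RSet ''B'' (nvar ''i'') (loss_exp (NConst 0)))
               (NSet ''next'' (nvar ''i'') (NConst 0)))
          (for_loop ''j'' (NConst 1) (nvar ''i'')
             (If (RLess (loss_exp (nvar ''j'')) (RGet ''B'' (nvar ''i'')))
                (Seq (RSet ''B'' (nvar ''i'') (loss_exp (nvar ''j'')))
                   (NSet ''next'' (nvar ''i'') (nvar ''j'')))
                Skip)))"

text \<open>The minimum is expressed by a bound over all \<open>k < r\<close> and its attainment at
  \<open>succ r\<close>, to match the assumptions of \<open>ranked_rules\<close>.\<close>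

lemma runs_loss_prog:
  fixes \<sigma> :: mem
  defines "t \<equiv> real_mem \<sigma> ''t''" and "q \<equiv> real_mem \<sigma> ''q''" and "rule \<equiv> nat_mem \<sigma> ''rule''"
  defines "loss \<equiv> (\<lambda>B r k. t (rule k) * (q (rule 0) - q (rule r)) + B k)"
  assumes n: "nat_mem \<sigma> ''n'' 0 = n" and B_0: "real_mem \<sigma> ''B'' 0 = 0"
  shows "runs P loss_prog \<sigma> ((n + 1) * (112 * n + 164) + 11)
    (\<lambda>\<tau>. nat_mem \<tau> ''n'' 0 = n \<and> nat_mem \<tau> ''len'' = nat_mem \<sigma> ''len'' \<and> nat_mem \<tau> ''rule'' = rule \<and>
       (let B = real_mem \<tau> ''B''; succ = nat_mem \<tau> ''next''
        in B 0 = 0 \<and> (\<forall>r. 0 < r \<and> r \<le> n \<longrightarrow>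
             (\<forall>k<r. B r \<le> loss B r k) \<and> succ r < r \<and> B r = loss B r (succ r))))"
proof -
  define frame where "frame = (\<lambda>\<tau> :: mem. nat_mem \<tau> ''n'' 0 = n \<and> nat_mem \<tau> ''len'' = nat_mem \<sigma> ''len'' \<and>
    nat_mem \<tau> ''rule'' = rule \<and> real_mem \<tau> ''t'' = t \<and> real_mem \<tau> ''q'' = q \<and> real_mem \<tau> ''B'' 0 = 0)"
  \<comment> \<open>Entry \<open>r\<close> holds the minimum over the candidates below
    \<open>m\<close>: with \<open>m = r\<close> for finished entries, with \<open>m = j\<close> for
    the one in progress.\<close>
  define best where "best = (\<lambda>(\<tau> :: mem) r m. (\<forall>k<m. real_mem \<tau> ''B'' r \<le> loss (real_mem \<tau> ''B'') r k) \<and>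
    nat_mem \<tau> ''next'' r < m \<and> real_mem \<tau> ''B'' r = loss (real_mem \<tau> ''B'') r (nat_mem \<tau> ''next'' r))"
  define Inv where "Inv = (\<lambda>i (\<tau> :: mem). nat_mem \<tau> ''i'' 0 = i \<and> 0 < i \<and> frame \<tau> \<and>
    (\<forall>r. 0 < r \<and> r < i \<longrightarrow> best \<tau> r r))"
  define Inv' where "Inv' = (\<lambda>i j (\<tau> :: mem). nat_mem \<tau> ''j'' 0 = j \<and> Inv i \<tau> \<and> 0 < j \<and> best \<tau> i j)"
  \<comment> \<open>Only cells up to \<open>r\<close> of \<open>B\<close> and cell \<open>r\<close>
    of \<open>next\<close> matter, so work on a later rank preserves the finished entries.\<close>
  have best_cong: "best \<tau>' r m \<longleftrightarrow> best \<tau> r m"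
    if "\<And>k. k \<le> r \<Longrightarrow> real_mem \<tau>' ''B'' k = real_mem \<tau> ''B'' k"
      "nat_mem \<tau>' ''next'' r = nat_mem \<tau> ''next'' r" "m \<le> r" for \<tau> \<tau>' r m
    using that by (auto simp: best_def loss_def)
  show ?thesis
    unfolding loss_prog_def
  proof (rule runs_for_loop[where Inv = Inv and l = 1 and m = "n + 1" and K = "112 * n + 150"])
    show "Inv 1 (nat_upd ''i'' 0 1 \<sigma>)"
      by (simp add: Inv_def frame_def n B_0 rule_def t_def q_def)
  next
    fix i \<tau> assume "Inv i \<tau>"
    then show "nat_mem \<tau> ''i'' 0 = i \<and> nval \<tau> (NAdd (nvar ''n'') (NConst 1)) = n + 1"
      by (simp add: Inv_def frame_def)
  next
    fix i \<tau> assume inv: "Inv i \<tau>" and "i < n + 1"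
    have i: "0 < i" "nat_mem \<tau> ''i'' 0 = i"
      using inv by (simp_all add: Inv_def)
    define \<tau>0 where "\<tau>0 = nat_upd ''next'' i 0 (real_upd ''B'' i (loss (real_mem \<tau> ''B'') i 0) \<tau>)"
    show "runs P (Seq (Seq (RSet ''B'' (nvar ''i'') (loss_exp (NConst 0)))
               (NSet ''next'' (nvar ''i'') (NConst 0)))
          (for_loop ''j'' (NConst 1) (nvar ''i'')
             (If (RLess (loss_exp (nvar ''j'')) (RGet ''B'' (nvar ''i'')))
                (Seq (RSet ''B'' (nvar ''i'') (loss_exp (nvar ''j'')))
                   (NSet ''next'' (nvar ''i'') (nvar ''j'')))
                Skip))) \<tau> (112 * n + 150)
        (\<lambda>\<rho>. nat_mem \<rho> ''i'' 0 = i \<and> Inv (Suc i) (nat_upd ''i'' 0 (Suc i) \<rho>))"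
    proof (rule runs_Seq)
      have "final P (Seq (RSet ''B'' (nvar ''i'') (loss_exp (NConst 0)))
          (NSet ''next'' (nvar ''i'') (NConst 0))) \<tau> = \<tau>0"
        using inv by (simp add: \<tau>0_def loss_exp_def loss_def Inv_def frame_def)
      then show "runs P (Seq (RSet ''B'' (nvar ''i'') (loss_exp (NConst 0)))
          (NSet ''next'' (nvar ''i'') (NConst 0))) \<tau> 100 (\<lambda>\<rho>. \<rho> = \<tau>0)"
        by (intro runs_straight) (simp_all add: loss_exp_def)
    next
      fix \<tau>1 assume \<tau>1: "\<tau>1 = \<tau>0"
      have "runs P (for_loop ''j'' (NConst 1) (nvar ''i'')
             (If (RLess (loss_exp (nvar ''j'')) (RGet ''B'' (nvar ''i'')))
                (Seq (RSet ''B'' (nvar ''i'') (loss_exp (nvar ''j'')))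
                   (NSet ''next'' (nvar ''i'') (nvar ''j'')))
                Skip)) \<tau>0 (i * 112 + 9)
        (\<lambda>\<rho>. nat_mem \<rho> ''i'' 0 = i \<and> Inv (Suc i) (nat_upd ''i'' 0 (Suc i) \<rho>))"
      proof (rule runs_for_loop[where Inv = "Inv' i" and l = 1 and m = i and K = 100])
        have "best (nat_upd ''j'' 0 1 \<tau>0) r r" if "0 < r" "r < i" for r
        proof -
          have "best (nat_upd ''j'' 0 1 \<tau>0) r r \<longleftrightarrow> best \<tau> r r"
            using that by (intro best_cong) (simp_all add: \<tau>0_def)
          then show ?thesis
            using inv that by (simp add: Inv_def)
        qed
        moreover have "best (nat_upd ''j'' 0 1 \<tau>0) i 1"
          using i by (simp add: best_def \<tau>0_def loss_def)
        ultimately show "Inv' i 1 (nat_upd ''j'' 0 1 \<tau>0)"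
          using inv by (simp add: Inv'_def Inv_def frame_def \<tau>0_def)
      next
        fix j \<rho> assume "Inv' i j \<rho>"
        then show "nat_mem \<rho> ''j'' 0 = j \<and> nval \<rho> (nvar ''i'') = i"
          by (simp add: Inv'_def Inv_def)
      next
        fix j \<rho> assume inv': "Inv' i j \<rho>" and "j < i"
        define x where "x = loss (real_mem \<rho> ''B'') i j"
        define \<rho>' where "\<rho>' = (if x < real_mem \<rho> ''B'' i
          then nat_upd ''next'' i j (real_upd ''B'' i x \<rho>) else \<rho>)"
        have final: "final P (If (RLess (loss_exp (nvar ''j'')) (RGet ''B'' (nvar ''i'')))
              (Seq (RSet ''B'' (nvar ''i'') (loss_exp (nvar ''j'')))
                 (NSet ''next'' (nvar ''i'') (nvar ''j'')))
              Skip) \<rho> = \<rho>'"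
          using inv' by (simp add: \<rho>'_def x_def loss_exp_def loss_def Inv'_def Inv_def frame_def)
        have "best (nat_upd ''j'' 0 (Suc j) \<rho>') r r" if "0 < r" "r < i" for r
        proof -
          have "best (nat_upd ''j'' 0 (Suc j) \<rho>') r r \<longleftrightarrow> best \<rho> r r"
            using that by (intro best_cong) (simp_all add: \<rho>'_def)
          then show ?thesis
            using inv' that by (simp add: Inv'_def Inv_def)
        qed
        moreover have "best (nat_upd ''j'' 0 (Suc j) \<rho>') i (Suc j)"
        proof -
          \<comment> \<open>The losses compared at rank \<open>i\<close> read \<open>B\<close> only
            below \<open>i\<close>, so overwriting \<open>B\<close> at \<open>i\<close> does not
            change them.\<close>
          have "best \<rho> i j"
            using inv' by (simp add: Inv'_def)
          then show ?thesis
            using \<open>j < i\<close> by (fastforce simp: best_def \<rho>'_def x_def loss_def less_Suc_eq)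
        qed
        ultimately have "nat_mem \<rho>' ''i'' 0 = i \<and> Inv' i (Suc j) (nat_upd ''j'' 0 (Suc j) \<rho>')"
          and "nat_mem \<rho>' ''j'' 0 = j"
          using inv' by (simp_all add: Inv'_def Inv_def frame_def \<rho>'_def)
        then show "runs P (If (RLess (loss_exp (nvar ''j'')) (RGet ''B'' (nvar ''i'')))
              (Seq (RSet ''B'' (nvar ''i'') (loss_exp (nvar ''j'')))
                 (NSet ''next'' (nvar ''i'') (nvar ''j'')))
              Skip) \<rho> 100 (\<lambda>\<rho>. nat_mem \<rho> ''j'' 0 = j \<and> Inv' i (Suc j) (nat_upd ''j'' 0 (Suc j) \<rho>))"
          by (intro runs_straight) (simp_all only: final, simp_all add: loss_exp_def)
      next
        fix \<rho> assume inv': "Inv' i i \<rho>"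
        have "best (nat_upd ''i'' 0 (Suc i) \<rho>) r r" if "0 < r" "r < Suc i" for r
        proof -
          have "best (nat_upd ''i'' 0 (Suc i) \<rho>) r r \<longleftrightarrow> best \<rho> r r"
            by (intro best_cong) simp_all
          then show ?thesis
            using inv' that by (auto simp: Inv'_def Inv_def less_Suc_eq)
        qed
        then show "nat_mem \<rho> ''i'' 0 = i \<and> Inv (Suc i) (nat_upd ''i'' 0 (Suc i) \<rho>)"
          using inv' by (simp add: Inv'_def Inv_def frame_def)
      qed (use i in simp_all)
      then show "runs P (for_loop ''j'' (NConst 1) (nvar ''i'')
             (If (RLess (loss_exp (nvar ''j'')) (RGet ''B'' (nvar ''i'')))
                (Seq (RSet ''B'' (nvar ''i'') (loss_exp (nvar ''j'')))
                   (NSet ''next'' (nvar ''i'') (nvar ''j'')))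
                Skip)) \<tau>1 (i * 112 + 9)
        (\<lambda>\<rho>. nat_mem \<rho> ''i'' 0 = i \<and> Inv (Suc i) (nat_upd ''i'' 0 (Suc i) \<rho>))"
        by (simp add: \<tau>1)
    qed (use \<open>i < n + 1\<close> in simp)
  next
    fix \<tau> assume "Inv (n + 1) \<tau>"
    then show "nat_mem \<tau> ''n'' 0 = n \<and> nat_mem \<tau> ''len'' = nat_mem \<sigma> ''len'' \<and> nat_mem \<tau> ''rule'' = rule \<and>
       (let B = real_mem \<tau> ''B''; succ = nat_mem \<tau> ''next''
        in B 0 = 0 \<and> (\<forall>r. 0 < r \<and> r \<le> n \<longrightarrow>
             (\<forall>k<r. B r \<le> loss B r k) \<and> succ r < r \<and> B r = loss B r (succ r)))"
      unfolding Inv_def frame_def best_def Let_def Suc_eq_plus1[symmetric] less_Suc_eq_le by blast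
  qed simp_all
qed

section \<open>Reading off the sequence along the path\<close>

text \<open>The pointer moves before a rule is written, so the start rank \<open>n\<close> yields no
  output while rank 0 does, as in \<open>rule_path\<close>.\<close>

definition out_prog :: com where
  "out_prog =
     Seq (NSet ''p'' (NConst 0) (nvar ''n''))
       (While (BNot (NEq (nvar ''p'') (NConst 0)))
          (Seq (NSet ''p'' (NConst 0) (NGet ''next'' (nvar ''p'')))
             (Seq (NSet ''out'' (nvar ''len'') (NGet ''rule'' (nvar ''p'')))
                (NSet ''len'' (NConst 0) (NAdd (nvar ''len'') (NConst 1))))))"

lemma runs_out_prog:
  fixes \<sigma> :: mem
  defines "rule \<equiv> nat_mem \<sigma> ''rule''" and "succ \<equiv> nat_mem \<sigma> ''next''"
  assumes n: "nat_mem \<sigma> ''n'' 0 = n" and len: "nat_mem \<sigma> ''len'' 0 = 0"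
    and succ_less: "\<And>r. 0 < r \<Longrightarrow> r \<le> n \<Longrightarrow> succ r < r"
  shows "runs P out_prog \<sigma> (100 * n + 100) (\<lambda>\<tau>. output_seq \<tau> = rule_path rule succ n)"
proof -
  \<comment> \<open>The output so far, followed by the path still ahead, is the whole path. The
    pointer falls in each round, which gives at most \<open>n\<close> rounds.\<close>
  define Inv where "Inv = (\<lambda>\<tau> :: mem. nat_mem \<tau> ''rule'' = rule \<and> nat_mem \<tau> ''next'' = succ \<and>
    nat_mem \<tau> ''p'' 0 \<le> n \<and>
    output_seq \<tau> @ rule_path rule succ (nat_mem \<tau> ''p'' 0) = rule_path rule succ n)"
  show ?thesis
    unfolding out_prog_def
  proof (rule runs_Seq)
    show "runs P (NSet ''p'' (NConst 0) (nvar ''n'')) \<sigma> 10 (\<lambda>\<tau>. Inv \<tau> \<and> nat_mem \<tau> ''p'' 0 = n)"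
      by (intro runs_straight) (simp_all add: Inv_def output_seq_def n len rule_def succ_def)
  next
    fix \<tau>0 assume \<tau>0: "Inv \<tau>0 \<and> nat_mem \<tau>0 ''p'' 0 = n"
    show "runs P (While (BNot (NEq (nvar ''p'') (NConst 0)))
          (Seq (NSet ''p'' (NConst 0) (NGet ''next'' (nvar ''p'')))
             (Seq (NSet ''out'' (nvar ''len'') (NGet ''rule'' (nvar ''p'')))
                (NSet ''len'' (NConst 0) (NAdd (nvar ''len'') (NConst 1)))))) \<tau>0 (100 * n + 10)
        (\<lambda>\<tau>. output_seq \<tau> = rule_path rule succ n)"
    proof (rule runs_While[where Inv = Inv and f = "\<lambda>\<tau>. nat_mem \<tau> ''p'' 0" and K = 50])
      fix \<tau> assume inv: "Inv \<tau>" and "bval P \<tau> (BNot (NEq (nvar ''p'') (NConst 0)))"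
      then have "0 < nat_mem \<tau> ''p'' 0"
        by simp
      moreover from this have less: "succ (nat_mem \<tau> ''p'' 0) < nat_mem \<tau> ''p'' 0"
        using inv by (intro succ_less) (simp_all add: Inv_def)
      moreover from less have "rule_path rule succ (nat_mem \<tau> ''p'' 0) =
          rule (succ (nat_mem \<tau> ''p'' 0)) # rule_path rule succ (succ (nat_mem \<tau> ''p'' 0))"
        by (subst rule_path.simps) simp
      ultimately show "runs P (Seq (NSet ''p'' (NConst 0) (NGet ''next'' (nvar ''p'')))
             (Seq (NSet ''out'' (nvar ''len'') (NGet ''rule'' (nvar ''p'')))
                (NSet ''len'' (NConst 0) (NAdd (nvar ''len'') (NConst 1)))))
          \<tau> 50 (\<lambda>\<rho>. Inv \<rho> \<and> nat_mem \<rho> ''p'' 0 < nat_mem \<tau> ''p'' 0)"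
        using inv by (intro runs_straight) (simp_all add: Inv_def output_seq_def)
    next
      fix \<tau> assume "Inv \<tau>" "\<not> bval P \<tau> (BNot (NEq (nvar ''p'') (NConst 0)))"
      moreover have "rule_path rule succ 0 = []"
        by (simp add: rule_path.simps)
      ultimately show "output_seq \<tau> = rule_path rule succ n"
        by (simp add: Inv_def)
    qed (use \<tau>0 in simp_all)
  qed simp
qed

section \<open>Composition of sorting, loss computation and output\<close>

theorem theorem4:
  "\<exists>(prog :: com) (T :: nat \<Rightarrow> nat).
     (\<lambda>n. real (T n)) \<in> O(\<lambda>n. real n ^ 2) \<and>
     (\<forall>(n :: nat) (t :: nat \<Rightarrow> nat) (q :: nat \<Rightarrow> real) (D :: real) (P :: real \<Rightarrow> real).
        n \<ge> 1 \<longrightarrow> (\<forall>i<n. q i \<ge> 0) \<longrightarrow>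
        P = cdf (uniform_measure lborel {0..D}) \<longrightarrow> D > real (\<Sum>i<n. t i) \<longrightarrow>
        (\<exists>k \<sigma>. exec P prog (input_mem n t q) k \<sigma> \<and> k \<le> T n \<and>
               optimal_sequence {..<n} P t q (output_seq \<sigma>)))"
\<comment> \<open>The three step bounds add up to \<open>224 * (n * n) + 411 * n + 289\<close>,
  which for \<open>n \<ge> 1\<close> is well below \<open>2000 * n ^ 2\<close>.\<close>
proof (rule exI[of _ "Seq sort_prog (Seq loss_prog out_prog)"], rule exI[of _ "\<lambda>n. 2000 * n ^ 2"],
    intro conjI allI impI)
  show "(\<lambda>n. real (2000 * n ^ 2)) \<in> O(\<lambda>n. real n ^ 2)"
    by simp
next
  fix n :: nat and t :: "nat \<Rightarrow> nat" and q :: "nat \<Rightarrow> real" and D :: real and P :: "real \<Rightarrow> real"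
  assume n: "1 \<le> n" and q: "\<forall>i<n. 0 \<le> q i"
    and P: "P = cdf (uniform_measure lborel {0..D})" and D: "real (\<Sum>i<n. t i) < D"
  define \<sigma> where "\<sigma> = input_mem n t q"
  \<comment> \<open>The array holds 0 in cell \<open>n\<close>, where \<open>q\<close> may be
    arbitrary; the initial candidate of the selection and the level of the start rank rely on
    this.\<close>
  define qe where "qe = real_mem \<sigma> ''q''"
  have qe: "qe i = (if i < n then q i else 0)" for i
    by (simp add: qe_def \<sigma>_def input_mem_def)
  have "runs P (Seq sort_prog (Seq loss_prog out_prog)) \<sigma> (2000 * n ^ 2)
    (\<lambda>\<tau>. optimal_sequence {..<n} P t q (output_seq \<tau>))"
  proof (rule runs_Seq)
    show "runs P sort_prog \<sigma> (n * (112 * n + 35) + 14)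
      (\<lambda>\<tau>. real_mem \<tau> = real_mem \<sigma> \<and> nat_mem \<tau> ''n'' 0 = n \<and> nat_mem \<tau> ''len'' = nat_mem \<sigma> ''len'' \<and>
         selected n qe n (nat_mem \<tau> ''rule'') \<and> nat_mem \<tau> ''rule'' n = n)"
      unfolding qe_def using q by (intro runs_sort_prog) (auto simp: \<sigma>_def input_mem_def)
    fix \<tau> :: mem assume \<tau>: "real_mem \<tau> = real_mem \<sigma> \<and> nat_mem \<tau> ''n'' 0 = n \<and>
      nat_mem \<tau> ''len'' = nat_mem \<sigma> ''len'' \<and>
      selected n qe n (nat_mem \<tau> ''rule'') \<and> nat_mem \<tau> ''rule'' n = n"
    define rule where "rule = nat_mem \<tau> ''rule''"
    have sel: "selected n qe n rule" "rule n = n"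
      using \<tau> by (simp_all add: rule_def)
    have B_0: "real_mem \<tau> ''B'' 0 = 0"
      by (simp add: \<tau> \<sigma>_def input_mem_def)
    have image: "rule ` {..<n} = {..<n}"
      by (rule selected_image[OF sel(1)])
    then have rule_less: "rule r < n" if "r < n" for r
      using that by blast
    show "runs P (Seq loss_prog out_prog) \<tau> ((n + 1) * (112 * n + 164) + 11 + (100 * n + 100))
      (\<lambda>\<tau>. optimal_sequence {..<n} P t q (output_seq \<tau>))"
    proof (rule runs_Seq[OF runs_loss_prog[OF _ B_0]])
      fix \<rho> :: mem assume \<rho>: "nat_mem \<rho> ''n'' 0 = n \<and> nat_mem \<rho> ''len'' = nat_mem \<tau> ''len'' \<and>
        nat_mem \<rho> ''rule'' = nat_mem \<tau> ''rule'' \<and>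
        (let B = real_mem \<rho> ''B''; succ = nat_mem \<rho> ''next''
         in B 0 = 0 \<and> (\<forall>r. 0 < r \<and> r \<le> n \<longrightarrow>
             (\<forall>k<r. B r \<le> real_mem \<tau> ''t'' (nat_mem \<tau> ''rule'' k) *
                (real_mem \<tau> ''q'' (nat_mem \<tau> ''rule'' 0) - real_mem \<tau> ''q'' (nat_mem \<tau> ''rule'' r)) + B k) \<and>
             succ r < r \<and>
             B r = real_mem \<tau> ''t'' (nat_mem \<tau> ''rule'' (succ r)) *
                (real_mem \<tau> ''q'' (nat_mem \<tau> ''rule'' 0) - real_mem \<tau> ''q'' (nat_mem \<tau> ''rule'' r)) + B (succ r)))"
      define B where "B = real_mem \<rho> ''B''"
      define succ where "succ = nat_mem \<rho> ''next''"
      have "real_mem \<tau> ''q'' = qe"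
        by (simp add: qe_def \<tau>)
      note \<rho>' = \<rho>[unfolded Let_def this, folded rule_def B_def succ_def]
      \<comment> \<open>A step enters a rank below \<open>n\<close>, where \<open>rule\<close> names
        an actual rule and the runtime array agrees with \<open>t\<close>.\<close>
      have te: "real_mem \<tau> ''t'' (rule k) = real (t (rule k))" if "k < n" for k
        using rule_less[OF that] by (simp add: \<tau> \<sigma>_def input_mem_def)
      have B: "B r \<le> real (t (rule k)) * (qe (rule 0) - qe (rule r)) + B k"
        if "k < r" "r \<le> n" for r k
      proof -
        have "B r \<le> real_mem \<tau> ''t'' (rule k) * (qe (rule 0) - qe (rule r)) + B k"
          using \<rho>' that by (meson le_less_trans zero_le)
        then show ?thesis
          using te[of k] that by simp
      qed
      have succ: "succ r < r" "B r = real (t (rule (succ r))) * (qe (rule 0) - qe (rule r)) + B (succ r)"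
        if "0 < r" "r \<le> n" for r
      proof -
        show "succ r < r"
          using \<rho>' that by blast
        then show "B r = real (t (rule (succ r))) * (qe (rule 0) - qe (rule r)) + B (succ r)"
          using \<rho>' that te[of "succ r"] by (metis less_le_trans)
      qed
      have qe_antimono: "qe (rule s) \<le> qe (rule r)" if "r \<le> s" "s \<le> n" for r s
      proof (cases "s = n")
        case True
        then show ?thesis
          using q by (simp add: qe sel)
      next
        case False
        then show ?thesis
          using selected_antimono[OF sel(1) that(1)] that by simp
      qed
      \<comment> \<open>The final contents of the arrays \<open>B\<close> and \<open>next\<close>
        are themselves the shortest path data.\<close>
      interpret ranked_rules n t q rule "\<lambda>r. qe (rule r)" B succ
      proof unfold_locales
        show "B 0 = 0"
          using \<rho>' by blast
      qed (use n image sel rule_less qe_antimono B succ in \<open>simp_all add: qe\<close>)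
      have "optimal_sequence {..<n} P t q (rule_path rule succ n)"
        using q by (intro optimal_path[OF _ P D]) blast
      moreover have "runs P out_prog \<rho> (100 * n + 100) (\<lambda>\<tau>. output_seq \<tau> = rule_path rule succ n)"
        using runs_out_prog[of \<rho> n P] \<rho> \<tau> succ(1) unfolding succ_def rule_def
        by (simp add: \<sigma>_def input_mem_def)
      ultimately show "runs P out_prog \<rho> (100 * n + 100) (\<lambda>\<tau>. optimal_sequence {..<n} P t q (output_seq \<tau>))"
        unfolding runs_def by metis
    qed (use \<tau> in simp_all)
  next
    have "n \<le> n * n" "1 \<le> n * n"
      using n by simp_all
    moreover have "n * (112 * n + 35) + 14 + ((n + 1) * (112 * n + 164) + 11 + (100 * n + 100)) =
        224 * (n * n) + 411 * n + 289"
      by (simp add: algebra_simps)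
    ultimately show "n * (112 * n + 35) + 14 + ((n + 1) * (112 * n + 164) + 11 + (100 * n + 100)) \<le> 2000 * n ^ 2"
      unfolding power2_eq_square by linarith
  qed
  then show "\<exists>k \<tau>. exec P (Seq sort_prog (Seq loss_prog out_prog)) (input_mem n t q) k \<tau> \<and>
      k \<le> 2000 * n ^ 2 \<and> optimal_sequence {..<n} P t q (output_seq \<tau>)"
    by (simp add: runs_def \<sigma>_def)
qed

end
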